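(* Let $n\ge 2$ and let $p(z)=z^n+a_1z^{n-1}+\cdots+a_{n-1}z+a_n$ be a complex polynomial of degree $n$ with zeros $z_1,\dots,z_n$ and critical points $w_1,\dots,w_{n-1}$. Assume $\sum_{j=1}^n z_j=0$. Then for every real $p\ge 2$, \[ \sum_{k=1}^{n-1}|w_k|^p\le \frac{n-2}{n}\sum_{j=1}^n|z_j|^p . \]
   Context: Zeros are listed with multiplicity. The critical points $w_1,\dots,w_{n-1}$ are the zeros of the derivative $p'(z)$, listed with multiplicity. *)

theory Defs
  imports "HOL-Analysis.Analysis" "HOL-Computational_Algebra.Polynomial"
begin

end

theory Submission
  imports Defs "Jordan_Normal_Form.Schur_Decomposition"
begin

text \<open>
  Let \<open>D = diag(z\<^sub>1, \<dots>, z\<^sub>n)\<close> and let \<open>Q\<close> be the orthogonal projection onto the complement of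
  \<open>v = (1, \<dots>, 1)/\<surd>n\<close>. The critical points together with \<open>0\<close> are the eigenvalues of \<open>B = Q D Q\<close>, so
  a unitary triangularisation gives an orthonormal basis \<open>f\<^sub>k\<close> with \<open>\<langle>f\<^sub>k, B f\<^sub>k\<rangle> = w\<^sub>k\<close> (or \<open>0\<close>).
  For \<open>p > 2\<close>, \<open>|x|\<^sup>p\<close> is a positive mixture of the functions \<open>max(0, |x| - s)\<^sup>2\<close>, so by scaling it
  suffices to treat \<open>max(0, |x| - 1)\<^sup>2\<close>.

  Write \<open>z = u + l\<close> with \<open>u\<close> the radial projection of \<open>z\<close> to the closed unit disc and let \<open>\<kappa>\<close> be the
  mean of \<open>u\<close>, which is minus the mean of \<open>l\<close>. Compressing \<open>diag(u)\<close> to the complement of \<open>v\<close> and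
  closing the \<open>v\<close>-channel with the feedback \<open>-cnj \<kappa>\<close> yields a contraction
  \<open>K = Q (diag(u) - c u u\<^sup>T) Q\<close>, where \<open>c = cnj \<kappa> / (n (1 + |\<kappa>|\<^sup>2))\<close>. Without the feedback the
  squared Frobenius norm of \<open>B - K\<close> would exceed the desired bound by \<open>|\<kappa>|\<^sup>2\<close>; the feedback lowers it
  by at least that much, so \<open>\<parallel>B - K\<parallel>\<^sup>2 \<le> (n - 2)/n \<Sum> |l\<^sub>j|\<^sup>2\<close>. Finally
  \<open>|w\<^sub>k| - 1 \<le> |\<langle>f\<^sub>k, (B - K) f\<^sub>k\<rangle>|\<close>.
\<close>

unbundle no vec_syntax
hide_const (open) Module.smult

subsection \<open>Unitary triangularisation\<close>

definition adjoint_mat :: "complex mat \<Rightarrow> complex mat" where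
  "adjoint_mat A = Matrix.mat (dim_col A) (dim_row A) (\<lambda>(i, j). cnj (A $$ (j, i)))"

lemma adjoint_mat_carrier [simp]: "A \<in> carrier_mat n m \<Longrightarrow> adjoint_mat A \<in> carrier_mat m n"
  unfolding adjoint_mat_def by (rule carrier_matI) auto

lemma index_adjoint_mat [simp]:
  "A \<in> carrier_mat n m \<Longrightarrow> i < m \<Longrightarrow> j < n \<Longrightarrow> adjoint_mat A $$ (i, j) = cnj (A $$ (j, i))"
  by (auto simp: adjoint_mat_def)

lemma index_mult_mat_sum:
  assumes "A \<in> carrier_mat n m" "B \<in> carrier_mat m l" "i < n" "j < l"
  shows "(A * B) $$ (i, j) = (\<Sum>k<m. A $$ (i, k) * B $$ (k, j))"
  using assms by (auto simp: scalar_prod_def atLeast0LessThan intro!: sum.cong)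

lemma adjoint_mat_mult:
  assumes "A \<in> carrier_mat n m" "B \<in> carrier_mat m l"
  shows "adjoint_mat (A * B) = adjoint_mat B * adjoint_mat A"
proof (rule eq_matI)
  have c: "A * B \<in> carrier_mat n l" "adjoint_mat B \<in> carrier_mat l m" "adjoint_mat A \<in> carrier_mat m n"
    using assms by auto
  show "dim_row (adjoint_mat (A * B)) = dim_row (adjoint_mat B * adjoint_mat A)"
    "dim_col (adjoint_mat (A * B)) = dim_col (adjoint_mat B * adjoint_mat A)"
    using assms by (auto simp: adjoint_mat_def)
  fix i j
  assume "i < dim_row (adjoint_mat B * adjoint_mat A)" "j < dim_col (adjoint_mat B * adjoint_mat A)"
  then have ij: "i < l" "j < n" using c by auto
  show "adjoint_mat (A * B) $$ (i, j) = (adjoint_mat B * adjoint_mat A) $$ (i, j)"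
    unfolding index_adjoint_mat[OF c(1) ij] index_mult_mat_sum[OF assms ij(2,1)]
      index_mult_mat_sum[OF c(2,3) ij]
    using ij assms by (auto intro!: sum.cong)
qed

lemma adjoint_four_block_one:
  assumes "U \<in> carrier_mat m m"
  shows "adjoint_mat (four_block_mat (1\<^sub>m 1) (0\<^sub>m 1 m) (0\<^sub>m m 1) U) =
    four_block_mat (1\<^sub>m 1) (0\<^sub>m 1 m) (0\<^sub>m m 1) (adjoint_mat U)"
  using assms by (intro eq_matI) (auto simp: adjoint_mat_def)

text \<open>Gram-Schmidt applied to a basis that starts with \<open>v\<close> keeps \<open>v\<close>
  as its first vector, and dividing each vector by its norm gives unitary columns. Only the
  direction of \<open>v\<close> survives this normalisation, hence the factor
  \<open>c\<close>.\<close>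

lemma unitary_completion:
  fixes v :: "complex vec"
  assumes v: "v \<in> carrier_vec n" and v0: "v \<noteq> 0\<^sub>v n" and n: "n \<noteq> 0"
  obtains W c where "W \<in> carrier_mat n n" "adjoint_mat W * W = 1\<^sub>m n" "col W 0 = c \<cdot>\<^sub>v v"
proof -
  interpret cof_vec_space n "TYPE(complex)" .
  define b where "b = basis_completion v"
  define ws where "ws = gram_schmidt n b"
  from basis_completion[OF v v0, folded b_def]
  have dist_b: "distinct b" and indep: "\<not> lin_dep (set b)" and b: "set b \<subseteq> carrier_vec n"
    and hdb: "hd b = v" and len_b: "length b = n" by auto
  from hdb len_b n obtain vs where bv: "b = v # vs" by (cases b, auto)
  from gram_schmidt_result[OF b dist_b indep refl, folded ws_def]
  have ws: "set ws \<subseteq> carrier_vec n" "corthogonal ws" "length ws = n"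
    by (auto simp: len_b)
  from gram_schmidt_hd[OF v, of vs, folded bv] have hdws: "hd ws = v" unfolding ws_def .
  then have ws0: "ws ! 0 = v" using ws(3) n by (metis hd_conv_nth list.size(3))
  define N where "N = (\<lambda>j. \<Sum>l<n. (cmod (ws ! j $ l))\<^sup>2)"
  define W where "W = Matrix.mat n n (\<lambda>(i, j). ws ! j $ i / of_real (sqrt (N j)))"
  have W: "W \<in> carrier_mat n n" by (simp add: W_def)
  have dim: "dim_vec (ws ! j) = n" if "j < n" for j using that ws by (metis carrier_vecD nth_mem subsetD)
  have orth: "((\<Sum>l<n. ws ! i $ l * cnj (ws ! j $ l)) = 0) = (i \<noteq> j)" if "i < n" "j < n" for i j
    using corthogonalD[OF ws(2), of i j] that ws(3) dim
    by (simp add: scalar_prod_def atLeast0LessThan)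
  have Nsum: "(\<Sum>l<n. ws ! i $ l * cnj (ws ! i $ l)) = of_real (N i)" for i
    by (simp add: N_def complex_norm_square del: of_real_power)
  have Npos: "N i > 0" if "i < n" for i
    proof -
    \<comment> \<open>\<open>corthogonal\<close> says that inner products vanish exactly off the
      diagonal, so its case \<open>i = j\<close> rules out a zero norm.\<close>
    have "N i \<noteq> 0" using orth[OF that that] Nsum[of i] by simp
    then show ?thesis by (simp add: N_def sum_nonneg less_le)
  qed
  have "adjoint_mat W * W = 1\<^sub>m n"
  proof (rule eq_matI)
    fix i j assume "i < dim_row (1\<^sub>m n :: complex mat)" "j < dim_col (1\<^sub>m n :: complex mat)"
    then have ij: "i < n" "j < n" by auto
    have "(adjoint_mat W * W) $$ (i, j) = (\<Sum>l<n. cnj (W $$ (l, i)) * W $$ (l, j))"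
      unfolding index_mult_mat_sum[OF adjoint_mat_carrier[OF W] W ij] using ij W by (intro sum.cong) auto
    also have "\<dots> = (\<Sum>l<n. ws ! j $ l * cnj (ws ! i $ l)) / (of_real (sqrt (N i)) * of_real (sqrt (N j)))"
      unfolding sum_divide_distrib using ij by (intro sum.cong) (auto simp: W_def)
    also have "\<dots> = (if i = j then 1 else 0)"
    proof (cases "i = j")
      case True
      have "complex_of_real (sqrt (N j)) * of_real (sqrt (N j)) = of_real (N j)"
        using Npos[OF ij(2)] by (simp flip: of_real_mult)
      then show ?thesis using Npos[OF ij(2)] Nsum[of j] True by simp
    qed (use orth[OF ij(2,1)] in auto)
    finally show "(adjoint_mat W * W) $$ (i, j) = 1\<^sub>m n $$ (i, j)" using ij by simp
  qed (use W in \<open>auto simp: adjoint_mat_def\<close>)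
  moreover have "col W 0 = (1 / of_real (sqrt (N 0))) \<cdot>\<^sub>v v"
    using n v ws0 by (intro eq_vecI) (auto simp: W_def)
  ultimately show ?thesis using W that by blast
qed

text \<open>Deflation by induction on \<open>es\<close>: an eigenvector for \<open>e\<close> gives
  the first column of a unitary matrix, which splits off a 1 x 1 block, and the remaining block has
  the remaining factors as its characteristic polynomial. The diagonal follows the order of the
  given list, so each prescribed root can be read off by its index.\<close>

theorem unitary_schur_decomposition:
  assumes A: "A \<in> carrier_mat n n"
    and c: "char_poly A = (\<Prod>e\<leftarrow>es. [:- e, 1:])"
  shows "\<exists>B U. U \<in> carrier_mat n n \<and> similar_mat_wit A B U (adjoint_mat U) \<and>
    upper_triangular B \<and> diag_mat B = es"
  using assms
proof (induct es arbitrary: n A)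
  case Nil
  with degree_monic_char_poly[of A n] have [simp]: "n = 0" by simp
  have "adjoint_mat (1\<^sub>m 0) = 1\<^sub>m 0" by (rule eq_matI) (auto simp: adjoint_mat_def)
  then show ?case using similar_mat_wit_refl[of A 0] Nil
    by (intro exI[of _ A] exI[of _ "1\<^sub>m 0"]) (auto simp: diag_mat_def)
next
  case (Cons e es n A)
  define m where "m = n - 1"
  note A = Cons(2)
  let ?cp = "char_poly A"
  from Cons(3) have cp: "?cp = [: -e, 1 :] * (\<Prod>e \<leftarrow> es. [:- e, 1:])" by auto
  have mon: "monic (\<Prod>e\<leftarrow> es. [:- e, 1:])" by (rule monic_prod_list, auto)
  have deg: "degree ?cp = Suc (degree (\<Prod>e\<leftarrow> es. [:- e, 1:]))" unfolding cp
    by (subst degree_mult_eq, insert mon, auto)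
  with degree_monic_char_poly[OF A] have n: "n \<noteq> 0" by auto
  then have nm: "n = Suc m" by (simp add: m_def)
  have "eigenvalue A e" unfolding eigenvalue_root_char_poly[OF A] cp by simp
  then obtain v where "eigenvector A v e" unfolding eigenvalue_def by blast
  then have v: "v \<in> carrier_vec n" and v0: "v \<noteq> 0\<^sub>v n" and ev: "A *\<^sub>v v = e \<cdot>\<^sub>v v"
    using A by (auto simp: eigenvector_def)
  obtain W c where W: "W \<in> carrier_mat n n" and VW: "adjoint_mat W * W = 1\<^sub>m n"
    and colW: "col W 0 = c \<cdot>\<^sub>v v"
    using unitary_completion[OF v v0 n] .
  define V where "V = adjoint_mat W"
  have V: "V \<in> carrier_mat n n" using W by (simp add: V_def)
  have VW: "V * W = 1\<^sub>m n" using VW by (simp add: V_def)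
  have WV: "W * V = 1\<^sub>m n" using mat_mult_left_right_inverse[OF V W VW] .
  define A' where "A' = V * A * W"
  have A': "A' \<in> carrier_mat n n" using A V W by (simp add: A'_def)
  have wit: "similar_mat_wit A' A V W"
    by (rule similar_mat_witI[of _ _ n]) (use A' A V W VW WV in \<open>auto simp: A'_def\<close>)
  have wit': "similar_mat_wit A A' W V" using similar_mat_wit_sym[OF wit] .
  have "A *\<^sub>v col W 0 = e \<cdot>\<^sub>v col W 0"
    unfolding colW mult_mat_vec[OF A v] ev smult_smult_assoc mult.commute[of c] ..
  moreover have "col A' 0 = V *\<^sub>v (A *\<^sub>v col W 0)"
  proof -
    have "col (V * (A * W)) 0 = V *\<^sub>v col (A * W) 0"
      using V A W n by (intro col_mult2) auto
    also have "col (A * W) 0 = A *\<^sub>v col W 0" using A W n by (intro col_mult2) auto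
    finally show ?thesis unfolding A'_def using V A W by simp
  qed
  ultimately have "col A' 0 = e \<cdot>\<^sub>v (V *\<^sub>v col W 0)"
    using mult_mat_vec[OF V, of "col W 0" e] W by (simp add: col_def)
  also have "V *\<^sub>v col W 0 = col (1\<^sub>m n) 0"
    using col_mult2[OF V W, of 0] n by (simp add: VW)
  \<comment> \<open>Unitarity sends the first column of \<open>W\<close> to the first unit vector,
    so \<open>A'\<close> is block upper triangular with corner \<open>e\<close>.\<close>
  finally have col0: "col A' 0 = e \<cdot>\<^sub>v unit_vec n 0" using n by simp
  obtain A1 A2 A0 A3 where split: "split_block A' 1 1 = (A1, A2, A0, A3)"
    by (cases "split_block A' 1 1") auto
  have "dim_row A' = 1 + m" "dim_col A' = 1 + m" using A' nm by auto
  from split_block[OF split this] have A1: "A1 \<in> carrier_mat 1 1" and A2: "A2 \<in> carrier_mat 1 m"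
    and A0: "A0 \<in> carrier_mat m 1" and A3: "A3 \<in> carrier_mat m m"
    and block: "A' = four_block_mat A1 A2 A0 A3" by auto
  have A'0: "A' $$ (i, 0) = (if i = 0 then e else 0)" if "i < n" for i
    using arg_cong[OF col0, of "\<lambda>v. v $ i"] that A' n by auto
  have A1e: "A1 = Matrix.mat 1 1 (\<lambda>_. e)"
    using A1 A'0[of 0] nm A3 by (intro eq_matI) (auto simp: block)
  have A00: "A0 = 0\<^sub>m m 1"
  proof (rule eq_matI)
    fix i j assume "i < dim_row (0\<^sub>m m 1 :: complex mat)" "j < dim_col (0\<^sub>m m 1 :: complex mat)"
    then show "A0 $$ (i, j) = 0\<^sub>m m 1 $$ (i, j)"
      using A'0[of "Suc i"] A1 A3 nm by (simp add: block)
  qed (use A0 in auto)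
  have "char_poly A' = [: -e,1 :] * (\<Prod> e \<leftarrow> es. [:- e, 1:])"
    using char_poly_similar[of A' A] wit unfolding similar_mat_def cp by blast
  moreover have "char_poly A' = char_poly A1 * char_poly A3"
    unfolding block A00 by (rule char_poly_four_block_zeros_col[OF A1 A2 A3])
  moreover have "char_poly A1 = [: -e,1 :]"
    by (simp add: A1e char_poly_defs det_def sign_def)
  ultimately have "char_poly A3 = (\<Prod>e\<leftarrow>es. [:- e, 1:])"
    by (metis mult_cancel_left pCons_eq_0_iff zero_neq_one)
  from Cons(1)[OF A3 this] obtain B U where U: "U \<in> carrier_mat m m"
    and sim: "similar_mat_wit A3 B U (adjoint_mat U)" and ut: "upper_triangular B" and diag: "diag_mat B = es"
    by blast
  from similar_mat_witD2[OF A3 sim] have B: "B \<in> carrier_mat m m"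
    and UU: "U * adjoint_mat U = 1\<^sub>m m" by auto
  \<comment> \<open>The unitary for the lower block is extended by a 1 in the corner, which leaves
    the split-off eigenvalue and the zeros below it untouched.\<close>
  let ?U = "four_block_mat (1\<^sub>m 1) (0\<^sub>m 1 m) (0\<^sub>m m 1) U"
  let ?V = "four_block_mat (1\<^sub>m 1) (0\<^sub>m 1 m) (0\<^sub>m m 1) (adjoint_mat U)"
  let ?B = "four_block_mat A1 (A2 * U) A0 B"
  have adj: "adjoint_mat U \<in> carrier_mat m m" using U by simp
  have "similar_mat_wit A' ?B ?U ?V"
    unfolding block
    by (rule similar_mat_wit_four_block[OF similar_mat_wit_refl[OF A1] sim _ _ A1 A3 A0])
      (use UU A2 U adj A00 A0 in \<open>auto simp: assoc_mult_mat[of _ 1 m _ m _ m]\<close>)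
  from similar_mat_wit_trans[OF wit' this]
  have "similar_mat_wit A ?B (W * ?U) (?V * V)" .
  moreover have U': "?U \<in> carrier_mat n n" using U nm by auto
  moreover have "?V * V = adjoint_mat (W * ?U)"
    unfolding adjoint_mat_mult[OF W U'] adjoint_four_block_one[OF U] V_def ..
  moreover have "upper_triangular ?B" unfolding A00
    by (intro upper_triangular_four_block[OF A1 B _ ut]) (auto simp: A1e)
  moreover have "diag_mat ?B = e # es"
    using diag_four_block_mat[OF A1 B] diag by (simp add: A1e diag_mat_def)
  ultimately show ?case using W by (intro exI[of _ ?B] exI[of _ "W * ?U"]) auto
qed

subsection \<open>Critical points as eigenvalues of a compression\<close>

text \<open>The matrix determinant lemma, obtained by evaluating the determinant of one bordered
  matrix through both of its Schur complements.\<close>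

lemma det_diagonal_plus_rank_one:
  fixes d a b :: "nat \<Rightarrow> complex"
  assumes d: "\<And>i. i < n \<Longrightarrow> d i \<noteq> 0"
  shows "det (Matrix.mat n n (\<lambda>(i, j). (if i = j then d i else 0) + a i * b j)) =
    (\<Prod>i<n. d i) * (1 + (\<Sum>i<n. a i * b i / d i))"
proof -
  let ?E = "Matrix.mat n n (\<lambda>(i, j). if i = j then d i else 0)"
  let ?F = "Matrix.mat n n (\<lambda>(i, j). if i = j then 1 / d i else 0)"
  let ?A = "Matrix.mat n 1 (\<lambda>(i, j). - a i)"
  let ?A' = "Matrix.mat n 1 (\<lambda>(i, j). - a i / d i)"
  let ?B = "Matrix.mat 1 n (\<lambda>(i, j). b j)"
  let ?B' = "Matrix.mat 1 n (\<lambda>(i, j). - b j)"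
  let ?C = "Matrix.mat 1 n (\<lambda>(i, j). - b j / d j)"
  let ?X = "Matrix.mat n n (\<lambda>(i, j). (if i = j then d i else 0) + a i * b j)"
  let ?t = "1 + (\<Sum>i<n. a i * b i / d i)"
  let ?T = "Matrix.mat 1 1 (\<lambda>(i, j). ?t)"
  \<comment> \<open>Clearing the last row of \<open>?N\<close> by column operations
    (\<open>?R\<close>) leaves \<open>?X\<close>; clearing it by row operations (\<open>?L\<close>,
    with \<open>?F\<close> the inverse of \<open>?E\<close>) leaves the scalar
    \<open>?t\<close>.\<close>
  let ?N = "four_block_mat ?E ?A ?B (1\<^sub>m 1)"
  let ?R = "four_block_mat (1\<^sub>m n) (0\<^sub>m n 1) ?B' (1\<^sub>m 1)"
  let ?L = "four_block_mat ?F (0\<^sub>m n 1) ?C (1\<^sub>m 1)"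
  have c: "?E \<in> carrier_mat n n" "?F \<in> carrier_mat n n" "?X \<in> carrier_mat n n" "?A \<in> carrier_mat n 1"
    "?A' \<in> carrier_mat n 1" "?B \<in> carrier_mat 1 n" "?B' \<in> carrier_mat 1 n" "?C \<in> carrier_mat 1 n"
    "?T \<in> carrier_mat 1 1" "1\<^sub>m 1 \<in> carrier_mat 1 1" "1\<^sub>m n \<in> carrier_mat n n"
    "0\<^sub>m n 1 \<in> carrier_mat n 1" "0\<^sub>m 1 n \<in> carrier_mat 1 n" by auto
  have N: "?N \<in> carrier_mat (n + 1) (n + 1)" and R: "?R \<in> carrier_mat (n + 1) (n + 1)"
    and L: "?L \<in> carrier_mat (n + 1) (n + 1)" by auto
  have "?N * ?R = four_block_mat ?X ?A (0\<^sub>m 1 n) (1\<^sub>m 1)"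
    unfolding mult_four_block_mat[OF c(1,4,6,10,11,12,7,10)]
    by (intro cong_four_block_mat eq_matI) (auto simp: scalar_prod_def)
  then have "det (?N * ?R) = det ?X"
    using det_four_block_mat_lower_left_zero[OF c(3,4) refl c(10)] by simp
  moreover have "det (?N * ?R) = det ?N"
    unfolding det_mult[OF N R] det_four_block_mat_upper_right_zero[OF c(11) refl c(7,10)] by simp
  ultimately have NX: "det ?N = det ?X" by simp
  have sumE: "(\<Sum>k<n. g k * (if k = j then h k else 0)) = g j * h j" if "j < n" for g h :: "nat \<Rightarrow> complex" and j
  proof -
    have "(\<Sum>k<n. g k * (if k = j then h k else 0)) = (\<Sum>k<n. if k = j then g k * h k else 0)"
      by (intro sum.cong) auto
    then show ?thesis using that by simp
  qed
  have sumF: "(\<Sum>k<n. (if i = k then g k else 0) * h k) = g i * h i" if "i < n" for g h :: "nat \<Rightarrow> complex" and i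
  proof -
    have "(\<Sum>k<n. (if i = k then g k else 0) * h k) = (\<Sum>k<n. if k = i then g k * h k else 0)"
      by (intro sum.cong) auto
    then show ?thesis using that by simp
  qed
  have p1: "?F * ?E + 0\<^sub>m n 1 * ?B = 1\<^sub>m n"
  proof (rule eq_matI)
    fix i j assume "i < dim_row (1\<^sub>m n :: complex mat)" "j < dim_col (1\<^sub>m n :: complex mat)"
    then have ij: "i < n" "j < n" by auto
    have "(?F * ?E) $$ (i, j) = (\<Sum>k<n. ?F $$ (i, k) * (if k = j then d k else 0))"
      unfolding index_mult_mat_sum[OF c(2,1) ij] using ij by (intro sum.cong) auto
    also have "\<dots> = 1\<^sub>m n $$ (i, j)" unfolding sumE[OF ij(2)] using ij d by auto
    finally show "(?F * ?E + 0\<^sub>m n 1 * ?B) $$ (i, j) = 1\<^sub>m n $$ (i, j)"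
      using ij by (simp add: left_mult_zero_mat[OF c(6)] del: index_mult_mat)
  qed auto
  have p2: "?F * ?A + 0\<^sub>m n 1 * 1\<^sub>m 1 = ?A'"
  proof (rule eq_matI)
    fix i j assume "i < dim_row ?A'" "j < dim_col ?A'"
    then have ij: "i < n" "j < 1" by auto
    have "(?F * ?A) $$ (i, j) = (\<Sum>k<n. (if i = k then 1 / d k else 0) * - a k)"
      unfolding index_mult_mat_sum[OF c(2,4) ij] using ij by (intro sum.cong) auto
    also have "\<dots> = ?A' $$ (i, j)" unfolding sumF[OF ij(1)] using ij by auto
    finally show "(?F * ?A + 0\<^sub>m n 1 * 1\<^sub>m 1) $$ (i, j) = ?A' $$ (i, j)"
      using ij by (simp add: left_mult_zero_mat[OF c(10)] del: index_mult_mat)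
  qed auto
  have p3: "?C * ?E + 1\<^sub>m 1 * ?B = 0\<^sub>m 1 n"
  proof (rule eq_matI)
    fix i j assume "i < dim_row (0\<^sub>m 1 n :: complex mat)" "j < dim_col (0\<^sub>m 1 n :: complex mat)"
    then have ij: "i < 1" "j < n" by auto
    have "(?C * ?E) $$ (i, j) = (\<Sum>k<n. (- b k / d k) * (if k = j then d k else 0))"
      unfolding index_mult_mat_sum[OF c(8,1) ij] using ij by (intro sum.cong) auto
    also have "\<dots> = - b j" unfolding sumE[OF ij(2)] using ij d by auto
    finally show "(?C * ?E + 1\<^sub>m 1 * ?B) $$ (i, j) = 0\<^sub>m 1 n $$ (i, j)"
      using ij by (simp add: left_mult_one_mat[OF c(6)] del: index_mult_mat(1))
  qed auto
  have p4: "?C * ?A + 1\<^sub>m 1 * 1\<^sub>m 1 = ?T"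
  proof (rule eq_matI)
    fix i j assume "i < dim_row ?T" "j < dim_col ?T"
    then have ij: "i < 1" "j < 1" by auto
    have "(?C * ?A) $$ (i, j) = (\<Sum>k<n. a k * b k / d k)"
      unfolding index_mult_mat_sum[OF c(8,4) ij] using ij by (intro sum.cong) auto
    then show "(?C * ?A + 1\<^sub>m 1 * 1\<^sub>m 1) $$ (i, j) = ?T $$ (i, j)"
      using ij by (simp add: left_mult_one_mat[OF c(10)] del: index_mult_mat(1))
  qed auto
  have "?L * ?N = four_block_mat (1\<^sub>m n) ?A' (0\<^sub>m 1 n) ?T"
    unfolding mult_four_block_mat[OF c(2,12,8,10,1,4,6,10)] p1 p2 p3 p4 ..
  then have "det (?L * ?N) = ?t"
    using det_four_block_mat_lower_left_zero[OF c(11,5) refl c(9)] det_single[OF c(9)] by simp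
  then have "det ?F * det ?N = ?t"
    unfolding det_mult[OF L N] det_four_block_mat_upper_right_zero[OF c(2) refl c(8,10)] by simp
  moreover have "det ?F = (\<Prod>i<n. 1 / d i)"
    by (subst det_upper_triangular[OF _ c(2)]) (auto simp: prod_list_diag_prod atLeast0LessThan)
  ultimately have h1: "(\<Prod>i<n. 1 / d i) * det ?X = ?t" by (simp only: NX)
  have h2: "(\<Prod>i<n. d i) * (\<Prod>i<n. 1 / d i) = 1"
    unfolding prod.distrib[symmetric] using d by (intro prod.neutral) auto
  have "det ?X = ((\<Prod>i<n. d i) * (\<Prod>i<n. 1 / d i)) * det ?X"
    unfolding h2 by (simp only: mult_1_left)
  also have "\<dots> = (\<Prod>i<n. d i) * ((\<Prod>i<n. 1 / d i) * det ?X)" by (rule mult.assoc)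
  finally show ?thesis unfolding h1 .
qed

text \<open>A nonzero difference has only finitely many roots. This permits comparing polynomials
  only where the divisions in a computation make sense.\<close>

lemma poly_eqI_cofinite:
  fixes p q :: "complex poly"
  assumes "finite S" "\<And>x. x \<notin> S \<Longrightarrow> poly p x = poly q x"
  shows "p = q"
proof (rule ccontr)
  assume "p \<noteq> q"
  then have "finite {x. poly (p - q) x = 0}" by (intro poly_roots_finite) simp
  moreover have "UNIV = S \<union> {x. poly (p - q) x = 0}" using assms(2) by auto
  ultimately show False using \<open>finite S\<close> infinite_UNIV_char_0[where 'a = complex] by (metis finite_Un)
qed

text \<open>The matrix is \<open>Q D Q\<close> in coordinates; its constant term is proportional to
  the sum of the zeros and vanishes. For generic x, multiplying x - \<open>Q D Q\<close> by a matrix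
  of determinant 1 leaves a diagonal plus rank-one matrix, whose determinant is x/n times the
  product-rule expansion of the derivative. The factor x is the eigenvalue 0 at the head of the
  list.\<close>

lemma char_poly_centered_compression:
  fixes z w :: "nat \<Rightarrow> complex"
  assumes n: "n > 0"
    and crit: "pderiv (\<Prod>j<n. [:- z j, 1:]) = smult (of_nat n) (\<Prod>k<n-1. [:- w k, 1:])"
    and centroid: "(\<Sum>j<n. z j) = 0"
  shows "char_poly (Matrix.mat n n (\<lambda>(i, j). (if i = j then z i else 0) - (z i + z j) / of_nat n)) =
    (\<Prod>e\<leftarrow>0 # map w [0..<n-1]. [:- e, 1:])"
proof (rule poly_eqI_cofinite)
  let ?N = "of_nat n :: complex"
  have N: "?N \<noteq> 0" using n by simp
  let ?B = "Matrix.mat n n (\<lambda>(i, j). (if i = j then z i else 0) - (z i + z j) / ?N)"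
  \<comment> \<open>The exceptional points: \<open>?E\<close> divides by x, and the rank-one
    determinant formula divides by \<open>x - z i\<close>.\<close>
  show "finite (insert 0 (z ` {..<n}))" by simp
  fix x assume "x \<notin> insert 0 (z ` {..<n})"
  then have x: "x \<noteq> 0" and xz: "\<And>i. i < n \<Longrightarrow> x - z i \<noteq> 0" by auto
  let ?Y = "Matrix.mat n n (\<lambda>(i, j). (if i = j then x else 0) - ((if i = j then z i else 0) - (z i + z j) / ?N))"
  let ?E = "Matrix.mat n n (\<lambda>(i, j). (if i = j then 1 else 0) + 1 * (- z j / (?N * x)))"
  let ?X = "Matrix.mat n n (\<lambda>(i, j). (if i = j then x - z i else 0) + z i * (1 / ?N))"
  have c: "?Y \<in> carrier_mat n n" "?E \<in> carrier_mat n n" by auto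
  have char: "poly (char_poly ?B) x = det ?Y"
  proof -
    have "- char_matrix ?B x = ?Y"
      by (rule eq_matI) (auto simp: char_matrix_def)
    then show ?thesis using char_poly_matrix[of ?B n x] by simp
  qed
  have YE: "?Y * ?E = ?X"
  proof (rule eq_matI)
    fix i j assume "i < dim_row ?X" "j < dim_col ?X"
    then have ij: "i < n" "j < n" by auto
    \<comment> \<open>As the zeros sum to 0, the all-ones vector is an eigenvector of
      \<open>?Y\<close> for x. Multiplying by \<open>?E\<close> therefore subtracts
      \<open>z j / ?N\<close> from every entry of column j, which cancels one half of the symmetric
      term.\<close>
    have rs: "(\<Sum>k<n. ?Y $$ (i, k)) = x"
      using ij N by (simp add: sum_subtractf sum.distrib add_divide_distrib centroid flip: sum_divide_distrib)
    have "(?Y * ?E) $$ (i, j) = (\<Sum>k<n. ?Y $$ (i, k) * ?E $$ (k, j))"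
      by (rule index_mult_mat_sum[OF c ij])
    also have "\<dots> = (\<Sum>k<n. (if k = j then ?Y $$ (i, k) else 0) - z j / (?N * x) * ?Y $$ (i, k))"
      using ij by (intro sum.cong) (auto simp: algebra_simps)
    also have "\<dots> = ?Y $$ (i, j) - z j / (?N * x) * x"
      unfolding sum_subtractf sum_distrib_left[symmetric] rs using ij by (simp add: sum.delta)
    also have "\<dots> = ?X $$ (i, j)" using ij x N by (auto simp: field_simps)
    finally show "(?Y * ?E) $$ (i, j) = ?X $$ (i, j)" .
  qed auto
  have "(\<Sum>j<n. 1 * (- z j / (?N * x)) / 1) = 0"
    using centroid by (simp add: sum_negf flip: sum_divide_distrib)
  then have "det ?E = 1"
    using det_diagonal_plus_rank_one[of n "\<lambda>_. 1" "\<lambda>_. 1" "\<lambda>j. - z j / (?N * x)"] by simp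
  then have "det ?Y = det ?X" using det_mult[OF c] YE by simp
  also have "\<dots> = (\<Prod>i<n. x - z i) * (1 + (\<Sum>i<n. z i * (1 / ?N) / (x - z i)))"
    by (rule det_diagonal_plus_rank_one[OF xz])
  \<comment> \<open>The 1 is spread over the n summands as 1/n each, so that every term acquires the
    common factor \<open>x / ?N\<close>.\<close>
  also have "1 + (\<Sum>i<n. z i * (1 / ?N) / (x - z i)) = (\<Sum>i<n. x / ?N * (1 / (x - z i)))"
  proof -
    have "1 + (\<Sum>i<n. z i * (1 / ?N) / (x - z i)) = (\<Sum>i<n. 1 / ?N + z i * (1 / ?N) / (x - z i))"
      using N by (simp add: sum.distrib)
    also have "\<dots> = (\<Sum>i<n. x / ?N * (1 / (x - z i)))"
      using xz N by (intro sum.cong refl) (simp add: divide_simps)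
    finally show ?thesis .
  qed
  also have "(\<Prod>i<n. x - z i) * \<dots> = x / ?N * (\<Sum>j<n. \<Prod>i\<in>{..<n} - {j}. x - z i)"
  proof -
    have "(\<Prod>i<n. x - z i) * (1 / (x - z j)) = (\<Prod>i\<in>{..<n} - {j}. x - z i)" if "j < n" for j
      using prod.remove[of "{..<n}" j "\<lambda>i. x - z i"] that xz[OF that] by simp
    then show ?thesis
      unfolding sum_distrib_left by (intro sum.cong refl) (metis lessThan_iff mult.left_commute)
  qed
  also have "(\<Sum>j<n. \<Prod>i\<in>{..<n} - {j}. x - z i) = poly (pderiv (\<Prod>j<n. [:- z j, 1:])) x"
    by (simp add: pderiv_prod poly_sum poly_prod pderiv_pCons)
  also have "x / ?N * \<dots> = poly (\<Prod>e\<leftarrow>0 # map w [0..<n-1]. [:- e, 1:]) x"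
    using N prod.distinct_set_conv_list[of "[0..<n-1]" "\<lambda>k. [:- w k, 1:]"]
    by (simp add: crit comp_def atLeast0LessThan)
  finally show "poly (char_poly ?B) x = poly (\<Prod>e\<leftarrow>0 # map w [0..<n-1]. [:- e, 1:]) x"
    using char by simp
qed

text \<open>\<open>f k\<close> is column k of the Schur unitary U. One unitarity relation gives unit
  length, the other the completeness relation over k, and the diagonal of the triangular form gives
  the prescribed values in order.\<close>

lemma orthonormal_frame_of_char_poly:
  fixes b :: "nat \<Rightarrow> nat \<Rightarrow> complex"
  assumes "char_poly (Matrix.mat n n (\<lambda>(i, j). b i j)) = (\<Prod>e\<leftarrow>es. [:- e, 1:])"
  obtains f where "\<And>k. k < n \<Longrightarrow> (\<Sum>i<n. (cmod (f k i))\<^sup>2) = 1"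
    "\<And>i j. i < n \<Longrightarrow> j < n \<Longrightarrow> (\<Sum>k<n. f k i * cnj (f k j)) = (if i = j then 1 else 0)"
    "\<And>k. k < n \<Longrightarrow> (\<Sum>i<n. \<Sum>j<n. cnj (f k i) * b i j * f k j) = es ! k"
proof -
  let ?A = "Matrix.mat n n (\<lambda>(i, j). b i j)"
  have A: "?A \<in> carrier_mat n n" by simp
  from unitary_schur_decomposition[OF A assms] obtain B U where U: "U \<in> carrier_mat n n"
    and wit: "similar_mat_wit ?A B U (adjoint_mat U)" and diag: "diag_mat B = es" by blast
  let ?V = "adjoint_mat U"
  have V: "?V \<in> carrier_mat n n" using U by simp
  from similar_mat_witD2[OF A wit] have UV: "U * ?V = 1\<^sub>m n" and VU: "?V * U = 1\<^sub>m n"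
    and B: "B \<in> carrier_mat n n" by auto
  from similar_mat_witD2[OF B similar_mat_wit_sym[OF wit]] have BV: "B = ?V * ?A * U" by blast
  show ?thesis
  proof (rule that[of "\<lambda>k i. U $$ (i, k)"])
    fix k assume k: "k < n"
    have "(\<Sum>i<n. cnj (U $$ (i, k)) * U $$ (i, k)) = (?V * U) $$ (k, k)"
      unfolding index_mult_mat_sum[OF V U k k] using U k by (intro sum.cong) auto
    also have "\<dots> = 1" using k by (simp add: VU)
    finally have "complex_of_real (\<Sum>i<n. (cmod (U $$ (i, k)))\<^sup>2) = of_real 1"
      by (simp add: complex_norm_square mult.commute del: of_real_power)
    then show "(\<Sum>i<n. (cmod (U $$ (i, k)))\<^sup>2) = 1" by (simp only: of_real_eq_iff)
    have VA: "?V * ?A \<in> carrier_mat n n" using V by simp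
    have "es ! k = B $$ (k, k)" using diag k B by (auto simp: diag_mat_def)
    also have "\<dots> = (\<Sum>j<n. (\<Sum>i<n. cnj (U $$ (i, k)) * b i j) * U $$ (j, k))"
      unfolding BV index_mult_mat_sum[OF VA U k k] using U k
      by (intro sum.cong) (auto simp: index_mult_mat_sum[OF V A k] simp del: index_mult_mat intro!: sum.cong)
    also have "\<dots> = (\<Sum>i<n. \<Sum>j<n. cnj (U $$ (i, k)) * b i j * U $$ (j, k))"
      unfolding sum_distrib_right by (rule sum.swap)
    finally show "(\<Sum>i<n. \<Sum>j<n. cnj (U $$ (i, k)) * b i j * U $$ (j, k)) = es ! k" by simp
  next
    fix i j assume ij: "i < n" "j < n"
    have "(\<Sum>k<n. U $$ (i, k) * cnj (U $$ (j, k))) = (U * ?V) $$ (i, j)"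
      unfolding index_mult_mat_sum[OF U V ij] using U ij by (intro sum.cong) auto
    also have "\<dots> = (if i = j then 1 else 0)" using ij by (simp add: UV)
    finally show "(\<Sum>k<n. U $$ (i, k) * cnj (U $$ (j, k))) = (if i = j then 1 else 0)" .
  qed
qed

subsection \<open>The truncated inequality\<close>

lemma complex_cmod_square_sum: "complex_of_real (\<Sum>i\<in>A. (cmod (x i))\<^sup>2) = (\<Sum>i\<in>A. x i * cnj (x i))"
  by (simp add: complex_norm_square del: of_real_power)

text \<open>Pythagoras: subtracting the mean is the orthogonal projection to the complement of the
  constant vectors.\<close>

lemma sum_cmod_square_diff_mean:
  assumes "n > 0" and m: "(\<Sum>i<n. x i) = of_nat n * m"
  shows "(\<Sum>i<n. (cmod (x i - m))\<^sup>2) = (\<Sum>i<n. (cmod (x i))\<^sup>2) - real n * (cmod m)\<^sup>2"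
proof -
  have m': "(\<Sum>i<n. cnj (x i)) = of_nat n * cnj m"
    using arg_cong[OF m, of cnj] by simp
  have "complex_of_real (\<Sum>i<n. (cmod (x i - m))\<^sup>2) =
    (\<Sum>i<n. x i * cnj (x i) - (cnj m * x i + m * cnj (x i)) + m * cnj m)"
    unfolding complex_cmod_square_sum by (intro sum.cong) (auto simp: algebra_simps)
  also have "\<dots> = (\<Sum>i<n. x i * cnj (x i)) - of_nat n * (m * cnj m)"
    by (simp add: sum.distrib sum_subtractf flip: sum_distrib_left) (simp add: m m' algebra_simps)
  also have "\<dots> = complex_of_real ((\<Sum>i<n. (cmod (x i))\<^sup>2) - real n * (cmod m)\<^sup>2)"
    unfolding complex_cmod_square_sum[symmetric] complex_norm_square[symmetric] by simp
  finally show ?thesis unfolding of_real_eq_iff .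
qed

text \<open>By Cauchy-Schwarz each diagonal coefficient is at most the norm of \<open>M\<close>
  applied to the unit vector \<open>f k\<close>, and by completeness the squares of these norms add
  up to the squared Frobenius norm.\<close>

lemma frame_trace_le_frobenius:
  fixes f M :: "nat \<Rightarrow> nat \<Rightarrow> complex"
  assumes unit: "\<And>k. k < n \<Longrightarrow> (\<Sum>i<n. (cmod (f k i))\<^sup>2) = 1"
    and parseval: "\<And>i j. i < n \<Longrightarrow> j < n \<Longrightarrow> (\<Sum>k<n. f k i * cnj (f k j)) = (if i = j then 1 else 0)"
  shows "(\<Sum>k<n. (cmod (\<Sum>i<n. \<Sum>j<n. cnj (f k i) * M i j * f k j))\<^sup>2) \<le> (\<Sum>i<n. \<Sum>j<n. (cmod (M i j))\<^sup>2)"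
proof -
  have "(cmod (\<Sum>i<n. \<Sum>j<n. cnj (f k i) * M i j * f k j))\<^sup>2 \<le> (\<Sum>i<n. (cmod (\<Sum>j<n. M i j * f k j))\<^sup>2)"
    if k: "k < n" for k
  proof -
    have "cmod (\<Sum>i<n. \<Sum>j<n. cnj (f k i) * M i j * f k j) = cmod (\<Sum>i<n. cnj (f k i) * (\<Sum>j<n. M i j * f k j))"
      by (simp add: sum_distrib_left mult.assoc)
    also have "\<dots> \<le> (\<Sum>i<n. \<bar>cmod (f k i)\<bar> * \<bar>cmod (\<Sum>j<n. M i j * f k j)\<bar>)"
      by (rule order_trans[OF norm_sum]) (simp add: norm_mult)
    also have "\<dots> \<le> L2_set (\<lambda>i. cmod (f k i)) {..<n} * L2_set (\<lambda>i. cmod (\<Sum>j<n. M i j * f k j)) {..<n}"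
      by (rule L2_set_mult_ineq)
    also have "\<dots> = sqrt (\<Sum>i<n. (cmod (\<Sum>j<n. M i j * f k j))\<^sup>2)"
      using unit[OF k] by (simp add: L2_set_def)
    finally have "(cmod (\<Sum>i<n. \<Sum>j<n. cnj (f k i) * M i j * f k j))\<^sup>2 \<le> (sqrt (\<Sum>i<n. (cmod (\<Sum>j<n. M i j * f k j))\<^sup>2))\<^sup>2"
      by (intro power_mono) auto
    then show ?thesis by (simp add: sum_nonneg)
  qed
  then have "(\<Sum>k<n. (cmod (\<Sum>i<n. \<Sum>j<n. cnj (f k i) * M i j * f k j))\<^sup>2)
      \<le> (\<Sum>k<n. \<Sum>i<n. (cmod (\<Sum>j<n. M i j * f k j))\<^sup>2)"
    by (intro sum_mono) auto
  also have "\<dots> = (\<Sum>i<n. \<Sum>j<n. (cmod (M i j))\<^sup>2)"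
  proof -
    have "(\<Sum>k<n. (cmod (\<Sum>j<n. M i j * f k j))\<^sup>2) = (\<Sum>j<n. (cmod (M i j))\<^sup>2)" for i
    proof -
      have "complex_of_real (\<Sum>k<n. (cmod (\<Sum>j<n. M i j * f k j))\<^sup>2) =
        (\<Sum>k<n. \<Sum>j<n. \<Sum>j'<n. M i j * cnj (M i j') * (f k j * cnj (f k j')))"
        unfolding complex_cmod_square_sum cnj_sum sum_product by (intro sum.cong) (auto simp: algebra_simps)
      also have "\<dots> = (\<Sum>j<n. \<Sum>k<n. \<Sum>j'<n. M i j * cnj (M i j') * (f k j * cnj (f k j')))"
        by (rule sum.swap)
      also have "\<dots> = (\<Sum>j<n. \<Sum>j'<n. M i j * cnj (M i j') * (\<Sum>k<n. f k j * cnj (f k j')))"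
        unfolding sum_distrib_left by (intro sum.cong refl sum.swap)
      also have "\<dots> = (\<Sum>j<n. M i j * cnj (M i j))"
        by (intro sum.cong refl) (simp add: parseval if_distrib sum.delta cong: if_cong)
      also have "\<dots> = complex_of_real (\<Sum>j<n. (cmod (M i j))\<^sup>2)"
        by (rule complex_cmod_square_sum[symmetric])
      finally show ?thesis unfolding of_real_eq_iff .
    qed
    then show ?thesis by (subst sum.swap) simp
  qed
  finally show ?thesis .
qed

section \<open>Radial projection to the unit disc and its remainder\<close>

text \<open>The maximum in the denominator treats the inside and the outside of the disc at once and
  excludes division by zero.\<close>

definition clip :: "complex \<Rightarrow> complex" where
  "clip x = x / of_real (max 1 (cmod x))"

lemma norm_clip: "cmod (clip x) \<le> 1"
  by (auto simp: clip_def norm_divide max_def)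

lemma norm_diff_clip: "cmod (x - clip x) = max 0 (cmod x - 1)"
proof (cases "cmod x \<le> 1")
  case True then show ?thesis by (simp add: clip_def max_def)
next
  case False
  then have x0: "x \<noteq> 0" by (metis norm_zero zero_le_one)
  have "x - clip x = of_real (1 - 1 / cmod x) * x"
    using False by (simp add: clip_def max_def left_diff_distrib)
  then have "cmod (x - clip x) = \<bar>1 - 1 / cmod x\<bar> * cmod x" by (simp only: norm_mult norm_of_real)
  also have "\<dots> = cmod x - 1" using False x0 by (simp add: field_simps abs_if)
  finally show ?thesis using False by simp
qed

text \<open>The remainder is zero inside the disc; outside it points in the direction of
  \<open>clip x\<close>, which has modulus 1 there. This alignment is what evaluates the cross term
  in the Frobenius estimate.\<close>

lemma diff_clip_eq: "x - clip x = of_real (cmod (x - clip x)) * clip x"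
proof (cases "cmod x \<le> 1")
  case True then show ?thesis by (simp add: clip_def max_def)
next
  case False
  then have "cmod x \<noteq> 0" by auto
  then show ?thesis unfolding norm_diff_clip using False
    by (simp add: clip_def max_def field_simps)
qed

lemma cnj_diff_clip_mult: "cnj (x - clip x) * clip x = of_real (cmod (x - clip x))"
proof (cases "cmod x \<le> 1")
  case True then show ?thesis by (simp add: clip_def max_def)
next
  case False
  then have "cmod (clip x) = 1" by (auto simp: clip_def max_def norm_divide)
  then have "clip x * cnj (clip x) = 1" by (metis complex_norm_square of_real_1 power_one)
  then show ?thesis
    by (subst diff_clip_eq) (simp add: mult.assoc mult.commute[of "cnj (clip x)"])
qed

section \<open>Compression with rank-one feedback: contraction and Frobenius estimates\<close>

lemma cmod_plus_square: "(cmod (x + y))\<^sup>2 = (cmod x)\<^sup>2 + 2 * Re (cnj x * y) + (cmod y)\<^sup>2"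
  unfolding cmod_power2 by (simp add: power2_eq_square algebra_simps)

text \<open>The left side is the form of Q (diag(u) - c u u^T) Q at f, with the transpose taken
  without conjugation; Q maps f to \<open>f - m\<close> and u to \<open>u - k\<close>, and Q can be
  moved onto the vector f.\<close>

lemma quadratic_form_compression:
  fixes f u :: "nat \<Rightarrow> complex"
  assumes n: "n > 0" and k: "(\<Sum>i<n. u i) = of_nat n * k" and m: "(\<Sum>i<n. f i) = of_nat n * m"
  shows "(\<Sum>i<n. \<Sum>j<n. cnj (f i) * ((if i = j then u i else 0) - (u i + u j) / of_nat n + k / of_nat n
      - c * (u i - k) * (u j - k)) * f j) =
    (\<Sum>i<n. u i * (f i - m) * cnj (f i - m)) - c * (\<Sum>i<n. u i * cnj (f i - m)) * (\<Sum>i<n. u i * (f i - m))"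
    (is "?L = ?R")
proof -
  let ?N = "of_nat n :: complex"
  have N: "?N \<noteq> 0" using n by simp
  define a b where "a = (\<Sum>i<n. u i * f i)" and "b = (\<Sum>i<n. u i * cnj (f i))"
  have m': "(\<Sum>i<n. cnj (f i)) = ?N * cnj m" using arg_cong[OF m, of cnj] by simp
  have row: "(\<Sum>j<n. cnj (f i) * ((if i = j then u i else 0) - (u i + u j) / ?N + k / ?N - c * (u i - k) * (u j - k)) * f j)
    = u i * f i * cnj (f i) - cnj (f i) * u i * m - cnj (f i) * (a / ?N) + cnj (f i) * (k * m)
      - c * (u i - k) * cnj (f i) * (a - ?N * k * m)" if "i < n" for i
  proof -
    have "(\<Sum>j<n. cnj (f i) * ((if i = j then u i else 0) - (u i + u j) / ?N + k / ?N - c * (u i - k) * (u j - k)) * f j)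
      = (\<Sum>j<n. (if i = j then u i * f i * cnj (f i) else 0) - cnj (f i) * u i / ?N * f j - cnj (f i) / ?N * (u j * f j)
        + cnj (f i) * k / ?N * f j - c * (u i - k) * cnj (f i) * (u j * f j) + c * (u i - k) * cnj (f i) * k * f j)"
      by (intro sum.cong) (auto simp: algebra_simps add_divide_distrib)
    also have "\<dots> = u i * f i * cnj (f i) - cnj (f i) * u i / ?N * (?N * m) - cnj (f i) / ?N * a
        + cnj (f i) * k / ?N * (?N * m) - c * (u i - k) * cnj (f i) * a + c * (u i - k) * cnj (f i) * k * (?N * m)"
      unfolding sum.distrib sum_subtractf sum_distrib_left[symmetric] m a_def using that by simp
    finally show ?thesis using N by (simp add: algebra_simps)
  qed
  have "?L = (\<Sum>i<n. u i * f i * cnj (f i) - cnj (f i) * u i * m - cnj (f i) * (a / ?N) + cnj (f i) * (k * m)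
      - c * (u i - k) * cnj (f i) * (a - ?N * k * m))"
    by (intro sum.cong refl row) auto
  also have "\<dots> = (\<Sum>i<n. u i * f i * cnj (f i) - m * (u i * cnj (f i)) - (a / ?N) * cnj (f i) + (k * m) * cnj (f i)
      - (c * (a - ?N * k * m)) * (u i * cnj (f i)) + (c * (a - ?N * k * m) * k) * cnj (f i))"
    by (intro sum.cong refl) (auto simp: algebra_simps)
  also have "\<dots> = (\<Sum>i<n. u i * f i * cnj (f i)) - m * b - (a / ?N) * (?N * cnj m) + (k * m) * (?N * cnj m)
      - (c * (a - ?N * k * m)) * b + (c * (a - ?N * k * m) * k) * (?N * cnj m)"
    unfolding sum.distrib sum_subtractf sum_distrib_left[symmetric] m' b_def by simp
  also have "\<dots> = (\<Sum>i<n. u i * f i * cnj (f i)) - m * b - cnj m * a + ?N * k * m * cnj m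
      - c * (b - ?N * k * cnj m) * (a - ?N * k * m)"
    using N by (simp add: algebra_simps)
  also have "\<dots> = ?R"
  proof -
    have "(\<Sum>i<n. u i * (f i - m) * cnj (f i - m)) =
      (\<Sum>i<n. u i * f i * cnj (f i) - m * (u i * cnj (f i)) - cnj m * (u i * f i) + m * cnj m * u i)"
      by (intro sum.cong) (auto simp: algebra_simps)
    also have "\<dots> = (\<Sum>i<n. u i * f i * cnj (f i)) - m * b - cnj m * a + m * cnj m * (?N * k)"
      by (simp add: sum.distrib sum_subtractf k a_def b_def flip: sum_distrib_left)
    finally have 1: "(\<Sum>i<n. u i * (f i - m) * cnj (f i - m)) = \<dots>" .
    have 2: "(\<Sum>i<n. u i * cnj (f i - m)) = b - ?N * k * cnj m"
      by (simp add: b_def algebra_simps sum_subtractf k flip: sum_distrib_left)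
    have 3: "(\<Sum>i<n. u i * (f i - m)) = a - ?N * k * m"
      by (simp add: a_def algebra_simps sum_subtractf k flip: sum_distrib_left)
    show ?thesis unfolding 1 2 3 by (simp add: algebra_simps)
  qed
  finally show ?thesis .
qed

text \<open>With g = Q f, the form equals the inner product of g with x - \<mu>, where x = u (g + d)
  and \<mu> is the mean of x. The norm of x - \<mu> is at most that of g: multiplication by u does
  not increase norms, and the constant fed in, d, is no larger in modulus than the constant taken
  out, \<mu>.\<close>

lemma contraction_feedback:
  fixes f u :: "nat \<Rightarrow> complex"
  assumes n: "n > 0" and u: "\<And>i. i < n \<Longrightarrow> cmod (u i) \<le> 1" and k: "(\<Sum>i<n. u i) = of_nat n * k"
    and f: "(\<Sum>i<n. (cmod (f i))\<^sup>2) = 1"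
    and c: "c = cnj k / (of_nat n * of_real (1 + (cmod k)\<^sup>2))"
  shows "cmod (\<Sum>i<n. \<Sum>j<n. cnj (f i) * ((if i = j then u i else 0) - (u i + u j) / of_nat n + k / of_nat n
      - c * (u i - k) * (u j - k)) * f j) \<le> 1"
proof -
  let ?N = "of_nat n :: complex"
  have N: "?N \<noteq> 0" using n by simp
  define m where "m = (\<Sum>i<n. f i) / ?N"
  have m: "(\<Sum>i<n. f i) = ?N * m" using N by (simp add: m_def)
  define g where "g = (\<lambda>i. f i - m)"
  have g0: "(\<Sum>i<n. g i) = 0" by (simp add: g_def sum_subtractf m)
  have g0': "(\<Sum>i<n. cnj (g i)) = 0" using arg_cong[OF g0, of cnj] by simp
  define G where "G = (\<Sum>i<n. (cmod (g i))\<^sup>2)"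
  have G1: "G \<le> 1" unfolding G_def g_def sum_cmod_square_diff_mean[OF n m] f by simp
  define q where "q = (\<Sum>i<n. u i * g i)"
  \<comment> \<open>The value of \<open>c\<close> is the solution of the feedback loop: it makes
    \<open>d = - cnj k * \<mu>\<close> although \<mu> itself depends on d. This relation is derived
    below from \<open>Nmu\<close>.\<close>
  define d where "d = - c * q"
  define y where "y = (\<lambda>i. g i + d)"
  define x where "x = (\<lambda>i. u i * y i)"
  define \<mu> where "\<mu> = (\<Sum>i<n. x i) / ?N"
  have x: "(\<Sum>i<n. x i) = ?N * \<mu>" using N by (simp add: \<mu>_def)
  have T: "1 + (cmod k)\<^sup>2 > 0" by (smt (verit) zero_le_power2)
  define t where "t = complex_of_real (1 + (cmod k)\<^sup>2)"
  have t: "t \<noteq> 0" "t = 1 + k * cnj k"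
    unfolding t_def of_real_eq_0_iff complex_norm_square[symmetric] using T by auto
  have Nmu: "?N * \<mu> = q + ?N * k * d"
    unfolding x[symmetric] x_def y_def q_def by (simp add: algebra_simps sum.distrib k flip: sum_distrib_left)
  have "d * (?N * t) = - cnj k * q" using N t(1) unfolding d_def c t_def[symmetric] by simp
  then have "?N * d = - cnj k * (?N * \<mu>)" unfolding Nmu t(2) by (simp add: algebra_simps)
  then have d: "d = - cnj k * \<mu>" using N by (metis mult.left_commute mult_cancel_left)
  have "cmod (?N * k) \<le> (\<Sum>i<n. cmod (u i))" unfolding k[symmetric] by (rule norm_sum)
  also have "\<dots> \<le> (\<Sum>i<n. 1)" by (intro sum_mono u) auto
  finally have k1: "cmod k \<le> 1" using n by (simp add: norm_mult)
  have dmu: "(cmod d)\<^sup>2 \<le> (cmod \<mu>)\<^sup>2"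
    unfolding d using k1 by (intro power_mono) (auto simp: norm_mult mult_left_le_one_le)
  \<comment> \<open>Energy balance: removing \<mu> costs n |\<mu>|^2, while adding d to the
    mean-free g gains n |d|^2, and |d| is at most |\<mu>|.\<close>
  have "(\<Sum>i<n. (cmod (x i - \<mu>))\<^sup>2) = (\<Sum>i<n. (cmod (x i))\<^sup>2) - real n * (cmod \<mu>)\<^sup>2"
    by (rule sum_cmod_square_diff_mean[OF n x])
  also have "(\<Sum>i<n. (cmod (x i))\<^sup>2) \<le> (\<Sum>i<n. (cmod (y i))\<^sup>2)"
    unfolding x_def using u by (intro sum_mono power_mono) (auto simp: norm_mult mult_left_le_one_le)
  also have "(\<Sum>i<n. (cmod (y i))\<^sup>2) = G + real n * (cmod d)\<^sup>2"
    using sum_cmod_square_diff_mean[OF n, of y d] by (simp add: y_def sum.distrib g0 G_def)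
  finally have X: "(\<Sum>i<n. (cmod (x i - \<mu>))\<^sup>2) \<le> G"
    using dmu n by (smt (verit) mult_left_mono of_nat_0_le_iff)
  have "(\<Sum>i<n. \<Sum>j<n. cnj (f i) * ((if i = j then u i else 0) - (u i + u j) / ?N + k / ?N
      - c * (u i - k) * (u j - k)) * f j) = (\<Sum>i<n. u i * g i * cnj (g i)) - c * (\<Sum>i<n. u i * cnj (g i)) * q"
    unfolding quadratic_form_compression[OF n k m] q_def g_def ..
  \<comment> \<open>The subtracted \<mu> term is zero, because g has mean 0.\<close>
  also have "\<dots> = (\<Sum>i<n. u i * g i * cnj (g i)) + d * (\<Sum>i<n. u i * cnj (g i)) - \<mu> * (\<Sum>i<n. cnj (g i))"
    by (simp add: d_def g0')
  also have "\<dots> = (\<Sum>i<n. cnj (g i) * (x i - \<mu>))"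
    unfolding x_def y_def by (simp add: algebra_simps sum.distrib sum_subtractf sum_distrib_left)
  also have "cmod \<dots> \<le> (\<Sum>i<n. ((cmod (g i))\<^sup>2 + (cmod (x i - \<mu>))\<^sup>2) / 2)"
  proof (rule order_trans[OF norm_sum], intro sum_mono)
    fix i
    show "cmod (cnj (g i) * (x i - \<mu>)) \<le> ((cmod (g i))\<^sup>2 + (cmod (x i - \<mu>))\<^sup>2) / 2"
      using sum_squares_bound[of "cmod (g i)" "cmod (x i - \<mu>)"] by (simp add: norm_mult)
  qed
  also have "\<dots> = (G + (\<Sum>i<n. (cmod (x i - \<mu>))\<^sup>2)) / 2"
    by (simp add: G_def sum.distrib flip: sum_divide_distrib)
  also have "\<dots> \<le> 1" using X G1 by simp
  finally show ?thesis .
qed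

text \<open>The matrix is Q (diag(l) + c u u^T) Q. Its squared norm splits into that of Q diag(l) Q,
  which exceeds the claimed bound by |k|^2, twice a cross term that is at most -|k|^2, and a
  rank-one part that is at most |k|^2; these contributions cancel.\<close>

lemma frobenius_compression:
  fixes l u :: "nat \<Rightarrow> complex"
  assumes n: "n > 0" and u: "\<And>i. i < n \<Longrightarrow> cmod (u i) \<le> 1" and k: "(\<Sum>i<n. u i) = of_nat n * k"
    and l: "(\<Sum>i<n. l i) = - of_nat n * k"
    and lu: "\<And>i. i < n \<Longrightarrow> cnj (l i) * u i = of_real (cmod (l i))"
    and ul: "\<And>i. i < n \<Longrightarrow> l i = of_real (cmod (l i)) * u i"
    and c: "c = cnj k / (of_nat n * of_real (1 + (cmod k)\<^sup>2))"
  shows "(\<Sum>i<n. \<Sum>j<n. (cmod ((if i = j then l i else 0) - (l i + l j) / of_nat n - k / of_nat n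
      + c * (u i - k) * (u j - k)))\<^sup>2) \<le> (real n - 2) / real n * (\<Sum>i<n. (cmod (l i))\<^sup>2)"
proof -
  let ?N = "of_nat n :: complex"
  have N: "?N \<noteq> 0" using n by simp
  define T where "T = 1 + (cmod k)\<^sup>2"
  have T: "T > 0" unfolding T_def by (smt (verit) zero_le_power2)
  define S where "S = (\<Sum>i<n. (cmod (l i))\<^sup>2)"
  define \<Lambda> where "\<Lambda> = (\<Sum>i<n. cmod (l i))"
  define a where "a = (\<lambda>i. u i - k)"
  have a0: "(\<Sum>i<n. a i) = 0" by (simp add: a_def sum_subtractf k)
  define A where "A = (\<Sum>i<n. (cmod (a i))\<^sup>2)"
  have l': "(\<Sum>i<n. cnj (l i)) = - ?N * cnj k" using arg_cong[OF l, of cnj] by simp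
  define b where "b = (\<lambda>i j. (if i = j then l i else 0) - (l i + l j + k) / ?N)"
  have entry: "(if i = j then l i else 0) - (l i + l j) / ?N - k / ?N + c * (u i - k) * (u j - k) =
      b i j + c * a i * a j" for i j
    by (simp add: b_def a_def add_divide_distrib)
  have expand: "(cmod (b i j + c * a i * a j))\<^sup>2 = (cmod (b i j))\<^sup>2 + 2 * Re (c * (cnj (b i j) * a i * a j))
      + (cmod c)\<^sup>2 * (cmod (a i))\<^sup>2 * (cmod (a j))\<^sup>2" for i j
    unfolding cmod_plus_square by (simp add: norm_mult power_mult_distrib algebra_simps)
  have alg: "(1 - 3 / N) * S - 2 / N * (- N * K) + N * (S / N\<^sup>2 - K / N) = (N - 2) / N * S + K" if "N > 0" for N K :: real
    using that by (simp add: field_simps power2_eq_square)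
  have pure: "(\<Sum>i<n. \<Sum>j<n. (cmod (b i j))\<^sup>2) = (real n - 2) / real n * S + (cmod k)\<^sup>2"
  proof -
    have row: "(\<Sum>j<n. (cmod (b i j))\<^sup>2) = (cmod (l i))\<^sup>2 * (1 - 3 / real n) - 2 * Re (l i * cnj k) / real n + S / (real n)\<^sup>2 - (cmod k)\<^sup>2 / real n" if "i < n" for i
    proof -
      \<comment> \<open>The diagonal correction is separated from the part that has the same form
        for all j, so the row sum involves only \<open>S\<close> and the sum of l.\<close>
      have entry2: "(cmod (b i j))\<^sup>2 = (if i = j then (1 - 4 / real n) * (cmod (l i))\<^sup>2 - 2 / real n * Re (l i * cnj k) else 0)
          + 1 / (real n)\<^sup>2 * ((cmod (l i + k))\<^sup>2 + (cmod (l j))\<^sup>2 + 2 * Re (cnj (l i + k) * l j))" for j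
      proof -
        define r where "r = 1 / real n"
        have "b i j = (if i = j then l i else 0) - of_real r * (l i + l j + k)"
          by (simp add: b_def r_def)
        note b = this
        have r: "4 / real n = 4 * r" "2 / real n = 2 * r" "1 / (real n)\<^sup>2 = r * r"
          by (simp_all add: r_def power2_eq_square)
        show ?thesis unfolding b r cmod_power2
          by (cases "i = j") (simp_all add: power2_eq_square algebra_simps)
      qed
      have alg: "(1 - 4 / N) * L - 2 / N * R + 1 / N\<^sup>2 * (N * (L + 2 * R + K) + S + 2 * (- N * (R + K)))
          = L * (1 - 3 / N) - 2 * R / N + S / N\<^sup>2 - K / N" if "N \<noteq> 0" for N L R K :: real
        using that by (simp add: field_simps power2_eq_square)
      have "(\<Sum>j<n. (cmod (b i j))\<^sup>2) = (1 - 4 / real n) * (cmod (l i))\<^sup>2 - 2 / real n * Re (l i * cnj k)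
          + 1 / (real n)\<^sup>2 * (real n * (cmod (l i + k))\<^sup>2 + S + 2 * Re (cnj (l i + k) * (\<Sum>j<n. l j)))"
        unfolding entry2 sum.distrib sum_distrib_left[symmetric] S_def Re_sum[symmetric] using that by simp
      also have "Re (cnj (l i + k) * (\<Sum>j<n. l j)) = - real n * (Re (l i * cnj k) + (cmod k)\<^sup>2)"
        unfolding l cmod_power2 by (simp add: power2_eq_square algebra_simps)
      also have "(cmod (l i + k))\<^sup>2 = (cmod (l i))\<^sup>2 + 2 * Re (l i * cnj k) + (cmod k)\<^sup>2"
        unfolding cmod_power2 by (simp add: power2_eq_square algebra_simps)
      finally show ?thesis using alg[of "real n" "(cmod (l i))\<^sup>2" "Re (l i * cnj k)" "(cmod k)\<^sup>2"] n by (simp only: of_nat_0_less_iff of_nat_eq_0_iff)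
    qed
    have "(\<Sum>i<n. \<Sum>j<n. (cmod (b i j))\<^sup>2) = (\<Sum>i<n. (1 - 3 / real n) * (cmod (l i))\<^sup>2 - 2 / real n * Re (l i * cnj k) + (S / (real n)\<^sup>2 - (cmod k)\<^sup>2 / real n))"
      by (intro sum.cong refl) (simp only: row lessThan_iff mult.commute[of "1 - 3 / real n"] times_divide_eq_left add_diff_eq)
    also have "\<dots> = (1 - 3 / real n) * S - 2 / real n * Re ((\<Sum>i<n. l i) * cnj k) + real n * (S / (real n)\<^sup>2 - (cmod k)\<^sup>2 / real n)"
      unfolding sum.distrib sum_subtractf sum_distrib_left[symmetric] sum_distrib_right[symmetric] S_def Re_sum[symmetric]
      using n by (simp add: right_diff_distrib)
    also have "Re ((\<Sum>i<n. l i) * cnj k) = - real n * (cmod k)\<^sup>2"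
      unfolding l cmod_power2 by (simp add: power2_eq_square algebra_simps)
    finally show ?thesis using alg[of "real n"] n by (simp only: of_nat_0_less_iff)
  qed
  \<comment> \<open>Off the diagonal, \<open>b i j\<close> is a sum of terms in i alone or in j
    alone; these drop out since a sums to 0. Expanding the square of \<open>u i - k\<close> on the
    diagonal and using \<open>lu\<close> and \<open>ul\<close> leaves only sums of l, of its
    conjugate and of |l|.\<close>
  have cross: "(\<Sum>i<n. \<Sum>j<n. cnj (b i j) * a i * a j) = - ?N * k - 2 * k * of_real \<Lambda> - ?N * k * k * cnj k"
  proof -
    have "(\<Sum>j<n. cnj (b i j) * a i * a j) = cnj (l i) * a i * a i - a i / ?N * (\<Sum>j<n. cnj (l j) * a j)" if "i < n" for i
    proof -
      have "(\<Sum>j<n. cnj (b i j) * a i * a j) = (\<Sum>j<n. (if i = j then cnj (l i) * a i * a i else 0)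
          - (cnj (l i) + cnj k) * a i / ?N * a j - a i / ?N * (cnj (l j) * a j))"
        by (intro sum.cong) (auto simp: b_def algebra_simps add_divide_distrib)
      then show ?thesis unfolding sum_subtractf sum_distrib_left[symmetric] a0 using that by simp
    qed
    then have "(\<Sum>i<n. \<Sum>j<n. cnj (b i j) * a i * a j) = (\<Sum>i<n. cnj (l i) * a i * a i) - (\<Sum>i<n. a i) / ?N * (\<Sum>j<n. cnj (l j) * a j)"
      by (simp add: sum_subtractf sum_divide_distrib sum_distrib_right)
    also have "\<dots> = (\<Sum>i<n. cnj (l i) * a i * a i)" by (simp add: a0)
    also have "\<dots> = (\<Sum>i<n. l i - 2 * k * of_real (cmod (l i)) + k * k * cnj (l i))"
    proof (intro sum.cong refl)
      fix i assume "i \<in> {..<n}"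
      then have i: "i < n" by simp
      have "cnj (l i) * a i * a i = (cnj (l i) * u i) * u i - 2 * k * (cnj (l i) * u i) + k * k * cnj (l i)"
        by (simp add: a_def algebra_simps)
      then show "cnj (l i) * a i * a i = l i - 2 * k * of_real (cmod (l i)) + k * k * cnj (l i)"
        unfolding lu[OF i] ul[OF i, symmetric] .
    qed
    also have "\<dots> = - ?N * k - 2 * k * of_real \<Lambda> - ?N * k * k * cnj k"
      by (simp add: sum.distrib sum_subtractf l l' \<Lambda>_def flip: sum_distrib_left)
    finally show ?thesis .
  qed
  \<comment> \<open>The phase of \<open>c\<close> makes the product real and nonpositive. Its
    modulus is |k|^2 (n T + 2 \<Lambda>) / (n T), which is at least |k|^2 because \<Lambda> is
    nonnegative.\<close>
  have Recross: "Re (c * (\<Sum>i<n. \<Sum>j<n. cnj (b i j) * a i * a j)) \<le> - (cmod k)\<^sup>2"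
  proof -
    have "c * (\<Sum>i<n. \<Sum>j<n. cnj (b i j) * a i * a j) = - (k * cnj k) * (?N + 2 * of_real \<Lambda> + ?N * (k * cnj k)) / (?N * of_real T)"
    proof -
      have "cnj k * (- ?N * k - 2 * k * of_real \<Lambda> - ?N * k * k * cnj k) =
          - (k * cnj k) * (?N + 2 * of_real \<Lambda> + ?N * (k * cnj k))"
        by (simp add: algebra_simps)
      then show ?thesis unfolding cross c T_def[symmetric] times_divide_eq_left by (rule arg_cong)
    qed
    also have "\<dots> = of_real (- (cmod k)\<^sup>2 * (real n + 2 * \<Lambda> + real n * (cmod k)\<^sup>2) / (real n * T))"
      unfolding complex_norm_square[symmetric] by simp
    finally have "Re (c * (\<Sum>i<n. \<Sum>j<n. cnj (b i j) * a i * a j)) = - (cmod k)\<^sup>2 * ((real n * T + 2 * \<Lambda>) / (real n * T))"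
      by (simp add: T_def algebra_simps)
    moreover have "(real n * T + 2 * \<Lambda>) / (real n * T) \<ge> 1"
      using T n by (simp add: \<Lambda>_def sum_nonneg field_simps)
    ultimately show ?thesis by (smt (verit) mult_left_mono zero_le_power2 mult_minus_left mult_cancel_left2)
  qed
  \<comment> \<open>Here |c| = |k| / (n T) with T at least 1, and A, the squared norm of Q u, is at
    most n.\<close>
  have last: "(cmod c)\<^sup>2 * A\<^sup>2 \<le> (cmod k)\<^sup>2"
  proof -
    have A: "A = (\<Sum>i<n. (cmod (u i))\<^sup>2) - real n * (cmod k)\<^sup>2"
      unfolding A_def a_def by (rule sum_cmod_square_diff_mean[OF n k])
    have "(\<Sum>i<n. (cmod (u i))\<^sup>2) \<le> (\<Sum>i<n. 1)"
      using u by (intro sum_mono) (auto simp: power_le_one)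
    then have "(\<Sum>i<n. (cmod (u i))\<^sup>2) \<le> real n" by simp
    moreover have "real n * (cmod k)\<^sup>2 \<ge> 0" by simp
    ultimately have "A \<le> real n" unfolding A by linarith
    moreover have "A \<ge> 0" by (simp add: A_def sum_nonneg)
    ultimately have "A / (real n * T) \<le> 1" and "A / (real n * T) \<ge> 0"
      using n T mult_mono[of A "real n" 1 T] by (auto simp: T_def)
    then have "(cmod k * (A / (real n * T)))\<^sup>2 \<le> (cmod k * 1)\<^sup>2"
      by (intro power_mono mult_left_mono mult_nonneg_nonneg) auto
    moreover have "cmod c = cmod k / (real n * T)"
      using T unfolding c T_def[symmetric] by (simp add: norm_divide norm_mult)
    ultimately show ?thesis by (simp add: power_mult_distrib power_divide)
  qed
  have A2: "A\<^sup>2 = (\<Sum>i<n. \<Sum>j<n. (cmod (a i))\<^sup>2 * (cmod (a j))\<^sup>2)"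
    unfolding power2_eq_square[of A] unfolding A_def sum_product ..
  have "(\<Sum>i<n. \<Sum>j<n. (cmod (b i j + c * a i * a j))\<^sup>2) = (\<Sum>i<n. \<Sum>j<n. (cmod (b i j))\<^sup>2)
      + 2 * Re (c * (\<Sum>i<n. \<Sum>j<n. cnj (b i j) * a i * a j)) + (cmod c)\<^sup>2 * A\<^sup>2"
    unfolding expand A2 by (simp only: sum.distrib sum_distrib_left Re_sum mult.assoc)
  then show ?thesis unfolding entry S_def[symmetric] using pure Recross last by linarith
qed

text \<open>The compression splits as M + K, where the form of K on a unit vector has modulus at
  most 1. Hence the excess over 1 is bounded by the form of M, whose squares over the frame are
  controlled by the Frobenius norm of M.\<close>

lemma sum_hinge_compression_le_unit:
  fixes z :: "nat \<Rightarrow> complex" and f :: "nat \<Rightarrow> nat \<Rightarrow> complex"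
  assumes n: "n > 0"
    and unit: "\<And>k. k < n \<Longrightarrow> (\<Sum>i<n. (cmod (f k i))\<^sup>2) = 1"
    and parseval: "\<And>i j. i < n \<Longrightarrow> j < n \<Longrightarrow> (\<Sum>k<n. f k i * cnj (f k j)) = (if i = j then 1 else 0)"
    and centroid: "(\<Sum>j<n. z j) = 0"
  shows "(\<Sum>k<n. (max 0 (cmod (\<Sum>i<n. \<Sum>j<n. cnj (f k i) * ((if i = j then z i else 0) - (z i + z j) / of_nat n) * f k j) - 1))\<^sup>2)
    \<le> (real n - 2) / real n * (\<Sum>j<n. (max 0 (cmod (z j) - 1))\<^sup>2)"
proof -
  let ?N = "of_nat n :: complex"
  have N: "?N \<noteq> 0" using n by simp
  define u where "u = (\<lambda>i. clip (z i))"
  define l where "l = (\<lambda>i. z i - clip (z i))"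
  define \<kappa> where "\<kappa> = (\<Sum>i<n. u i) / ?N"
  define c where "c = cnj \<kappa> / (?N * of_real (1 + (cmod \<kappa>)\<^sup>2))"
  have sum_u: "(\<Sum>i<n. u i) = ?N * \<kappa>" using N by (simp add: \<kappa>_def)
  \<comment> \<open>Since z is centred, the means of the clipped part and of the remainder are
    opposite; thus the \<kappa> terms cancel in M + K, as do the feedback terms.\<close>
  have sum_l: "(\<Sum>i<n. l i) = - ?N * \<kappa>"
    using sum_u by (simp add: l_def u_def sum_subtractf centroid)
  define M where "M = (\<lambda>i j. (if i = j then l i else 0) - (l i + l j) / ?N - \<kappa> / ?N + c * (u i - \<kappa>) * (u j - \<kappa>))"
  define K where "K = (\<lambda>i j. (if i = j then u i else 0) - (u i + u j) / ?N + \<kappa> / ?N - c * (u i - \<kappa>) * (u j - \<kappa>))"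
  have MK: "(if i = j then z i else 0) - (z i + z j) / ?N = M i j + K i j" for i j
    by (simp add: M_def K_def l_def u_def diff_divide_distrib add_divide_distrib)
  have "(max 0 (cmod (\<Sum>i<n. \<Sum>j<n. cnj (f k i) * ((if i = j then z i else 0) - (z i + z j) / ?N) * f k j) - 1))\<^sup>2
    \<le> (cmod (\<Sum>i<n. \<Sum>j<n. cnj (f k i) * M i j * f k j))\<^sup>2" if k: "k < n" for k
  proof -
    have "(\<Sum>i<n. \<Sum>j<n. cnj (f k i) * ((if i = j then z i else 0) - (z i + z j) / ?N) * f k j)
      = (\<Sum>i<n. \<Sum>j<n. cnj (f k i) * M i j * f k j) + (\<Sum>i<n. \<Sum>j<n. cnj (f k i) * K i j * f k j)"
      unfolding MK by (simp only: distrib_left distrib_right sum.distrib)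
    moreover have "cmod (\<Sum>i<n. \<Sum>j<n. cnj (f k i) * K i j * f k j) \<le> 1"
      unfolding K_def by (rule contraction_feedback[OF n _ sum_u unit[OF k] c_def]) (simp add: u_def norm_clip)
    ultimately show ?thesis
      using norm_triangle_ineq[of "\<Sum>i<n. \<Sum>j<n. cnj (f k i) * M i j * f k j" "\<Sum>i<n. \<Sum>j<n. cnj (f k i) * K i j * f k j"]
      by (intro power_mono) auto
  qed
  then have "(\<Sum>k<n. (max 0 (cmod (\<Sum>i<n. \<Sum>j<n. cnj (f k i) * ((if i = j then z i else 0) - (z i + z j) / ?N) * f k j) - 1))\<^sup>2)
      \<le> (\<Sum>k<n. (cmod (\<Sum>i<n. \<Sum>j<n. cnj (f k i) * M i j * f k j))\<^sup>2)"
    by (intro sum_mono) simp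
  also have "\<dots> \<le> (\<Sum>i<n. \<Sum>j<n. (cmod (M i j))\<^sup>2)"
    by (rule frame_trace_le_frobenius[OF unit parseval])
  also have "\<dots> \<le> (real n - 2) / real n * (\<Sum>i<n. (cmod (l i))\<^sup>2)"
    unfolding M_def
    by (rule frobenius_compression[OF n _ sum_u sum_l _ _ c_def])
      (simp_all add: u_def l_def norm_clip cnj_diff_clip_mult diff_clip_eq[symmetric] del: complex_cnj_diff)
  also have "(\<Sum>i<n. (cmod (l i))\<^sup>2) = (\<Sum>j<n. (max 0 (cmod (z j) - 1))\<^sup>2)"
    by (simp add: l_def norm_diff_clip)
  finally show ?thesis .
qed

text \<open>The form is linear in z, so dividing z by s reduces to threshold 1, and both sides scale
  by the square of s.\<close>

lemma sum_hinge_compression_le: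
  fixes z :: "nat \<Rightarrow> complex" and f :: "nat \<Rightarrow> nat \<Rightarrow> complex"
  assumes n: "n > 0" and s: "s > 0"
    and unit: "\<And>k. k < n \<Longrightarrow> (\<Sum>i<n. (cmod (f k i))\<^sup>2) = 1"
    and parseval: "\<And>i j. i < n \<Longrightarrow> j < n \<Longrightarrow> (\<Sum>k<n. f k i * cnj (f k j)) = (if i = j then 1 else 0)"
    and centroid: "(\<Sum>j<n. z j) = 0"
  shows "(\<Sum>k<n. (max 0 (cmod (\<Sum>i<n. \<Sum>j<n. cnj (f k i) * ((if i = j then z i else 0) - (z i + z j) / of_nat n) * f k j) - s))\<^sup>2)
    \<le> (real n - 2) / real n * (\<Sum>j<n. (max 0 (cmod (z j) - s))\<^sup>2)"
proof -
  let ?N = "of_nat n :: complex"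
  define y where "y = (\<lambda>j. z j / of_real s)"
  have sy: "z j = of_real s * y j" for j using s by (simp add: y_def)
  have y0: "(\<Sum>j<n. y j) = 0" using centroid by (simp add: y_def flip: sum_divide_distrib)
  have scale: "(max 0 (cmod (of_real s * x) - s))\<^sup>2 = s\<^sup>2 * (max 0 (cmod x - 1))\<^sup>2" for x
  proof -
    have "max 0 (cmod (of_real s * x) - s) = s * max 0 (cmod x - 1)"
      using s by (simp add: norm_mult max_def algebra_simps)
    then show ?thesis by (simp add: power_mult_distrib)
  qed
  have "(\<Sum>i<n. \<Sum>j<n. cnj (f k i) * ((if i = j then z i else 0) - (z i + z j) / ?N) * f k j) =
    of_real s * (\<Sum>i<n. \<Sum>j<n. cnj (f k i) * ((if i = j then y i else 0) - (y i + y j) / ?N) * f k j)" for k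
    unfolding sum_distrib_left sy by (intro sum.cong refl) (auto simp: algebra_simps add_divide_distrib)
  then show ?thesis
    using mult_left_mono[OF sum_hinge_compression_le_unit[OF n unit parseval y0], of "s\<^sup>2"]
    unfolding sy scale sum_distrib_left[symmetric] mult.left_commute[of "s\<^sup>2" "(real n - 2) / real n"]
    by (simp only: scale sum_distrib_left[symmetric] mult.left_commute[of "s\<^sup>2" "(real n - 2) / real n"] zero_le_power2)
qed

subsection \<open>Powers as mixtures of truncated squares\<close>

text \<open>The constant is the Beta integral B(p - 2, 3). Up to x the integrand has an explicit
  antiderivative, and beyond x it is zero, so the upper limit T may be shared by different
  x.\<close>

lemma has_integral_powr_hinge:
  fixes p x T :: real
  assumes p: "p > 2" and x: "0 \<le> x" "x \<le> T"
  shows "((\<lambda>s. s powr (p - 3) * (max 0 (x - s))\<^sup>2) has_integral 2 / (p * (p - 1) * (p - 2)) * x powr p) {0..T}"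
proof -
  define F where "F = (\<lambda>s. x\<^sup>2 * (s powr (p - 2) / (p - 2)) - 2 * x * (s powr (p - 1) / (p - 1)) + s powr p / p)"
  have cont: "continuous_on {0..x} F"
    unfolding F_def using p by (intro continuous_on_add continuous_on_diff continuous_on_mult_left continuous_on_divide
      continuous_on_powr' continuous_on_id continuous_on_const ballI) auto
  have deriv: "(F has_vector_derivative s powr (p - 3) * (x - s)\<^sup>2) (at s)" if "s \<in> {0<..<x}" for s
  proof -
    from that have s: "s > 0" by simp
    have shift: "s powr q' = s powr (p - 3) * s powr q" if "q' = p - 3 + q" for q q'
      unfolding that by (rule powr_add)
    have pw: "s powr (p - 1) = s powr (p - 3) * s\<^sup>2" "s powr (p - 2) = s powr (p - 3) * s"
      using s shift[of "p - 1" 2] shift[of "p - 2" 1] by simp_all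
    have "(F has_real_derivative x\<^sup>2 * ((p - 2) * s powr (p - 2 - 1) / (p - 2))
        - 2 * x * ((p - 1) * s powr (p - 1 - 1) / (p - 1)) + p * s powr (p - 1) / p) (at s)"
      unfolding F_def
      by (intro DERIV_add DERIV_diff DERIV_cmult DERIV_cdivide has_real_derivative_powr s)
    also have "x\<^sup>2 * ((p - 2) * s powr (p - 2 - 1) / (p - 2))
        - 2 * x * ((p - 1) * s powr (p - 1 - 1) / (p - 1)) + p * s powr (p - 1) / p
        = x\<^sup>2 * s powr (p - 3) - 2 * x * s powr (p - 2) + s powr (p - 1)"
      using p by simp
    also have "\<dots> = s powr (p - 3) * (x - s)\<^sup>2"
      unfolding pw by (simp add: power2_eq_square algebra_simps)
    finally show ?thesis unfolding has_real_derivative_iff_has_vector_derivative .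
  qed
  \<comment> \<open>For p < 3 the weight is unbounded near 0, so the derivative is taken in the
    interior only; F is still continuous at 0 because p > 2.\<close>
  have "((\<lambda>s. s powr (p - 3) * (x - s)\<^sup>2) has_integral F x - F 0) {0..x}"
    by (rule fundamental_theorem_of_calculus_interior[OF x(1) cont deriv])
  moreover have "F x - F 0 = 2 / (p * (p - 1) * (p - 2)) * x powr p"
  proof (cases "x = 0")
    case False
    have "x powr (p - 2) * x\<^sup>2 = x powr p" "x powr (p - 1) * x = x powr p"
      using False x powr_add[of x "p - 2" 2] powr_add[of x "p - 1" 1] by simp_all
    then have "F x = x powr p / (p - 2) - 2 * x powr p / (p - 1) + x powr p / p"
      unfolding F_def by (simp add: mult_ac)
    also have "\<dots> = x powr p * (1 / (p - 2) - 2 / (p - 1) + 1 / p)" by (simp add: algebra_simps)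
    also have "1 / (p - 2) - 2 / (p - 1) + 1 / p = 2 / (p * (p - 1) * (p - 2))"
      using p by (simp add: divide_simps) (simp add: algebra_simps)
    finally show ?thesis by (simp add: F_def)
  qed (simp add: F_def)
  ultimately have "((\<lambda>s. s powr (p - 3) * (x - s)\<^sup>2) has_integral 2 / (p * (p - 1) * (p - 2)) * x powr p) {0..x}"
    by (simp only:)
  then have "((\<lambda>s. s powr (p - 3) * (max 0 (x - s))\<^sup>2) has_integral 2 / (p * (p - 1) * (p - 2)) * x powr p) {0..x}"
    by (rule has_integral_eq[rotated]) simp
  moreover have "((\<lambda>s. s powr (p - 3) * (max 0 (x - s))\<^sup>2) has_integral 0) {x..T}"
    by (rule has_integral_is_0) simp
  ultimately show ?thesis using has_integral_combine[OF x] by (metis (no_types, lifting) add.right_neutral)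
qed

text \<open>For p > 2 the truncated inequality is multiplied by the nonnegative weight
  \<open>s powr (p - 3)\<close> and integrated over s. The weight is not integrable at 0 for p = 2,
  where letting s tend to 0 gives the claim directly.\<close>

lemma sum_powr_le_of_hinge_le:
  fixes a :: "'a \<Rightarrow> real" and b :: "'b \<Rightarrow> real" and c p :: real
  assumes fin: "finite A" "finite B" and a: "\<And>i. i \<in> A \<Longrightarrow> a i \<ge> 0" and b: "\<And>j. j \<in> B \<Longrightarrow> b j \<ge> 0"
    and p: "p \<ge> 2"
    and le: "\<And>s. s > 0 \<Longrightarrow> (\<Sum>i\<in>A. (max 0 (a i - s))\<^sup>2) \<le> c * (\<Sum>j\<in>B. (max 0 (b j - s))\<^sup>2)"
  shows "(\<Sum>i\<in>A. a i powr p) \<le> c * (\<Sum>j\<in>B. b j powr p)"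
proof (cases "p = 2")
  case True
  have "((\<lambda>s. \<Sum>i\<in>A. (max 0 (a i - s))\<^sup>2) \<longlongrightarrow> (\<Sum>i\<in>A. (max 0 (a i - 0))\<^sup>2)) (at_right 0)"
    by (intro tendsto_intros)
  moreover have "((\<lambda>s. c * (\<Sum>j\<in>B. (max 0 (b j - s))\<^sup>2)) \<longlongrightarrow> c * (\<Sum>j\<in>B. (max 0 (b j - 0))\<^sup>2)) (at_right 0)"
    by (intro tendsto_intros)
  ultimately have "(\<Sum>i\<in>A. (max 0 (a i - 0))\<^sup>2) \<le> c * (\<Sum>j\<in>B. (max 0 (b j - 0))\<^sup>2)"
    by (intro tendsto_le[of "at_right (0::real)"]) (auto simp: le eventually_at_filter)
  moreover have "(\<Sum>i\<in>A. (max 0 (a i - 0))\<^sup>2) = (\<Sum>i\<in>A. a i powr p)"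
    "(\<Sum>j\<in>B. (max 0 (b j - 0))\<^sup>2) = (\<Sum>j\<in>B. b j powr p)"
    using a b True by (auto intro!: sum.cong simp: max_def powr_numeral)
  ultimately show ?thesis by simp
next
  case False
  then have p2: "p > 2" using p by simp
  define K where "K = 2 / (p * (p - 1) * (p - 2))"
  have K: "K > 0" using p2 by (simp add: K_def)
  \<comment> \<open>A single upper limit of integration that dominates every \<open>a i\<close> and
    every \<open>b j\<close>.\<close>
  define T where "T = sum a A + sum b B"
  have sums: "sum a A \<ge> 0" "sum b B \<ge> 0" using a b by (auto intro: sum_nonneg)
  have aT: "a i \<le> T" if "i \<in> A" for i
    using member_le_sum[of i A a] a fin that sums by (auto simp: T_def)
  have bT: "b j \<le> T" if "j \<in> B" for j
    using member_le_sum[of j B b] b fin that sums by (auto simp: T_def)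
  have "((\<lambda>s. \<Sum>i\<in>A. s powr (p - 3) * (max 0 (a i - s))\<^sup>2) has_integral (\<Sum>i\<in>A. K * a i powr p)) {0..T}"
    unfolding K_def using fin a aT p2 by (intro has_integral_sum has_integral_powr_hinge) auto
  moreover have "((\<lambda>s. c * (\<Sum>j\<in>B. s powr (p - 3) * (max 0 (b j - s))\<^sup>2)) has_integral c * (\<Sum>j\<in>B. K * b j powr p)) {0..T}"
    unfolding K_def using fin b bT p2 by (intro has_integral_mult_right has_integral_sum has_integral_powr_hinge) auto
  ultimately have "(\<Sum>i\<in>A. K * a i powr p) \<le> c * (\<Sum>j\<in>B. K * b j powr p)"
  proof (rule has_integral_le)
    \<comment> \<open>At s = 0 both integrands vanish, as \<open>0 powr (p - 3)\<close> is 0 by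
      convention; the hypothesis covers all other s.\<close>
    fix s assume "s \<in> {0..T}"
    then show "(\<Sum>i\<in>A. s powr (p - 3) * (max 0 (a i - s))\<^sup>2) \<le> c * (\<Sum>j\<in>B. s powr (p - 3) * (max 0 (b j - s))\<^sup>2)"
      using mult_left_mono[OF le[of s], of "s powr (p - 3)"]
      by (cases "s = 0") (auto simp: mult.left_commute simp flip: sum_distrib_left)
  qed
  then have "K * (\<Sum>i\<in>A. a i powr p) \<le> K * (c * (\<Sum>j\<in>B. b j powr p))"
    by (simp add: mult.left_commute flip: sum_distrib_left)
  then show ?thesis using K by simp
qed

section \<open>From the compression to the critical points\<close>

theorem theorem1p1:
  fixes P :: "complex poly" and n :: nat
    and z :: "nat \<Rightarrow> complex" and w :: "nat \<Rightarrow> complex" and p :: real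
  assumes "n \<ge> 2"
    and zeros: "P = (\<Prod>j<n. [:- z j, 1:])"
    and crit: "pderiv P = smult (of_nat n) (\<Prod>k<n-1. [:- w k, 1:])"
    and centroid: "(\<Sum>j<n. z j) = 0"
    and "p \<ge> 2"
  shows "(\<Sum>k<n-1. cmod (w k) powr p) \<le> (real n - 2) / real n * (\<Sum>j<n. cmod (z j) powr p)"
proof -
  from \<open>n \<ge> 2\<close> have n: "n > 0" by simp
  let ?es = "0 # map w [0..<n-1]"
  let ?q = "\<lambda>f k. \<Sum>i<n. \<Sum>j<n. cnj (f k i) * ((if i = j then z i else 0) - (z i + z j) / of_nat n) * f k j"
  obtain f where unit: "\<And>k. k < n \<Longrightarrow> (\<Sum>i<n. (cmod (f k i))\<^sup>2) = 1"
    and parseval: "\<And>i j. i < n \<Longrightarrow> j < n \<Longrightarrow> (\<Sum>k<n. f k i * cnj (f k j)) = (if i = j then 1 else 0)"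
    and diag: "\<And>k. k < n \<Longrightarrow> ?q f k = ?es ! k"
    by (rule orthonormal_frame_of_char_poly[OF char_poly_centered_compression[OF n crit[unfolded zeros] centroid]])
      (rule that)
  have "(\<Sum>k<n. cmod (?q f k) powr p) \<le> (real n - 2) / real n * (\<Sum>j<n. cmod (z j) powr p)"
    by (rule sum_powr_le_of_hinge_le)
      (use sum_hinge_compression_le[OF n _ unit parseval centroid] \<open>p \<ge> 2\<close> in auto)
  moreover have "(\<Sum>k<n. cmod (?q f k) powr p) = (\<Sum>k<n-1. cmod (w k) powr p)"
  proof -
    \<comment> \<open>Writing n as \<open>Suc (n - 1)\<close> lets the index shift split off the
      head of \<open>?es\<close>; this extra eigenvalue 0 contributes \<open>0 powr p\<close>, which
      is 0.\<close>
    have "(\<Sum>k<n. cmod (?q f k) powr p) = (\<Sum>k<Suc (n - 1). cmod (?es ! k) powr p)"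
      using n by (intro sum.cong) (simp_all add: diag)
    also have "\<dots> = (\<Sum>k<n-1. cmod (w k) powr p)"
      unfolding sum.lessThan_Suc_shift by simp
    finally show ?thesis .
  qed
  ultimately show ?thesis by simp
qed

end
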